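(* Let $\mathbb{S}$, $N$, $R$, $H$, $\theta(a,b)$ and $P(x,a,b)$ be as in the context, let $0<\alpha<1$, let $M\ge1$ be an integer, and put $n=\lceil\alpha M\rceil$. For $x\in\mathbb{S}$ set $$q_M(x)=\sum_{t=n}^{M}\binom{t-1}{t-n}P(x,a,b)^n\,(1-P(x,a,b))^{t-n}.$$ Let $\{x_k\}$ be the time-homogeneous Markov chain on $\mathbb{S}$ with transition probabilities $$P_{xx'}(M)=\begin{cases}R(x,x')\,q_M(x') & \text{if } x'\in N(x),\\ 1-\sum_{y\in\mathbb{S}}R(x,y)\,q_M(y) & \text{if } x'=x,\\ 0&\text{otherwise.}\end{cases}$$ Then the vector $\pi_r(M)=(\pi_{x(r)}(M))_{x\in\mathbb{S}}$ with $$\pi_{x(r)}(M)=\frac{q_M(x)}{\sum_{x'\in\mathbb{S}}q_M(x')}$$ is the stationary probability distribution of $\{x_k\}$.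
   Context: $\mathbb{S}$ is a finite set. For each $x\in\mathbb{S}$, $H(x)$ is a real random variable with $E[H(x)^2]<\infty$ and $f(x)=E[H(x)]$; the underlying problem is to minimize $f$ over $\mathbb{S}$. For reals $a<b$, $\theta(a,b)$ is a random variable uniform on $[a,b]$, independent of $H(x)$, and $P(x,a,b)=\Pr(H(x)\le\theta(a,b))$. The parameters $a<b$ are chosen so that $0<P(x,a,b)<1$ for all $x\in\mathbb{S}$ and $f(x)<f(x')$ implies $P(x,a,b)>P(x',a,b)$. Each $x\in\mathbb{S}$ has a neighbor set $N(x)\subseteq\mathbb{S}\setminus\{x\}$. The function $R:\mathbb{S}\times\mathbb{S}\to[0,1]$ satisfies $R(x,x')>0\iff x'\in N(x)$ and $\sum_{x'\in\mathbb{S}}R(x,x')=1$ for all $x$. Reachability: for any $x,x'\in\mathbb{S}$ there is a finite sequence from $x$ to $x'$ in which each element is a neighbor of the preceding one. Symmetry: $x'\in N(x)\implies x\in N(x')$, and $R(x,x')=R(x',x)$ for all $x,x'\in\mathbb{S}$. The chain describes the relaxed stochastic ruler method with a constant number $M$ of tests: from $x$ a candidate $x'$ is drawn with probability $R(x,x')$ and is accepted if at least $\lceil\alpha M\rceil$ of $M$ independent tests, each successful with probability $P(x',a,b)$, succeed. *)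

theory Defs
  imports "HOL-Probability.Probability"
begin

definition ruler_prob ::
  "'w measure \<Rightarrow> ('s \<Rightarrow> 'w \<Rightarrow> real) \<Rightarrow> (real \<Rightarrow> real \<Rightarrow> 'w \<Rightarrow> real) \<Rightarrow> 's \<Rightarrow> real \<Rightarrow> real \<Rightarrow> real"
  where "ruler_prob \<Omega> H \<theta> x a b = \<P>(\<omega> in \<Omega>. H x \<omega> \<le> \<theta> a b \<omega>)"

(* p is the success probability of a single test.  The t-th summand is the probability
   that the n-th success occurs exactly at test t, so for 1 \<le> n this is the probability of at
   least n successes in M independent tests.  Since n \<le> t, the natural subtraction t - n is
   exact, and t - 1 is exact as soon as 1 \<le> n. *)
definition accept_prob :: "real \<Rightarrow> nat \<Rightarrow> real \<Rightarrow> real"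
  where "accept_prob \<alpha> M p =
    (let n = nat \<lceil>\<alpha> * real M\<rceil> in
      \<Sum>t = n..M. real ((t - 1) choose (t - n)) * p ^ n * (1 - p) ^ (t - n))"

definition ruler_transition ::
  "'s set \<Rightarrow> ('s \<Rightarrow> 's set) \<Rightarrow> ('s \<Rightarrow> 's \<Rightarrow> real) \<Rightarrow> ('s \<Rightarrow> real) \<Rightarrow> 's \<Rightarrow> 's \<Rightarrow> real"
  where "ruler_transition S N R q x x' =
    (if x' \<in> N x then R x x' * q x'
     else if x' = x then 1 - (\<Sum>y\<in>S. R x y * q y)
     else 0)"

definition transition_matrix :: "'s set \<Rightarrow> ('s \<Rightarrow> 's \<Rightarrow> real) \<Rightarrow> bool"
  where "transition_matrix S p \<longleftrightarrow>
    (\<forall>x\<in>S. \<forall>y\<in>S. 0 \<le> p x y) \<and> (\<forall>x\<in>S. (\<Sum>y\<in>S. p x y) = 1)"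

definition stationary_distribution :: "'s set \<Rightarrow> ('s \<Rightarrow> 's \<Rightarrow> real) \<Rightarrow> ('s \<Rightarrow> real) \<Rightarrow> bool"
  where "stationary_distribution S p \<pi> \<longleftrightarrow>
    (\<forall>x\<in>S. 0 \<le> \<pi> x) \<and> (\<Sum>x\<in>S. \<pi> x) = 1 \<and>
    (\<forall>y\<in>S. (\<Sum>x\<in>S. \<pi> x * p x y) = \<pi> y)"

(* The sequence s is a possible history; only its values at 0, ..., k + 1 matter. *)
definition markov_chain ::
  "'v measure \<Rightarrow> 's set \<Rightarrow> ('s \<Rightarrow> 's \<Rightarrow> real) \<Rightarrow> (nat \<Rightarrow> 'v \<Rightarrow> 's) \<Rightarrow> bool"
  where "markov_chain W S p X \<longleftrightarrow>
    prob_space W \<and> (\<forall>k. X k \<in> measurable W (count_space S)) \<and>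
    (\<forall>k s. (\<forall>i\<le>Suc k. s i \<in> S) \<longrightarrow> \<P>(\<omega> in W. \<forall>i\<le>k. X i \<omega> = s i) > 0 \<longrightarrow>
       \<P>(\<omega> in W. X (Suc k) \<omega> = s (Suc k) \<bar> \<forall>i\<le>k. X i \<omega> = s i) = p (s k) (s (Suc k)))"

end

theory Submission
  imports Defs
begin

text \<open>
  As \<open>R\<close> is symmetric, \<open>q x * p x y = q y * p y x\<close>: the chain is reversible with respect to
  \<open>q\<close>, so the normalised \<open>q\<close> is stationary. If \<open>\<mu>\<close> is stationary then, by reversibility,
  \<open>\<mu> x / q x\<close> is harmonic for \<open>p\<close>. A harmonic function that is maximal at \<open>x\<close> takes the
  same value at every \<open>y\<close> with \<open>p x y > 0\<close>, so reachability makes it constant.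
\<close>

section \<open>Bounds on the acceptance probability\<close>

text \<open>\<open>neg_binomial_pmf\<close> counts the failures before the last required success,
  hence the shift: stopping at test \<open>t\<close> means \<open>t - n\<close> failures. The
  summands thereby become masses of a single distribution.\<close>

lemma accept_prob_eq_neg_binomial:
  assumes "p \<in> {0<..1}"
  shows "accept_prob \<alpha> M p = (\<Sum>t = nat \<lceil>\<alpha> * real M\<rceil>..M.
    pmf (neg_binomial_pmf (nat \<lceil>\<alpha> * real M\<rceil>) p) (t - nat \<lceil>\<alpha> * real M\<rceil>))"
  unfolding accept_prob_def Let_def
  by (intro sum.cong) (auto simp: pmf_neg_binomial[OF assms])

lemma accept_prob_le_1:
  assumes "p \<in> {0<..1}"
  shows "accept_prob \<alpha> M p \<le> 1"
proof -
  define n where "n = nat \<lceil>\<alpha> * real M\<rceil>"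
  have "accept_prob \<alpha> M p = (\<Sum>t = n..M. pmf (neg_binomial_pmf n p) (t - n))"
    using accept_prob_eq_neg_binomial[OF assms] by (simp add: n_def)
  \<comment> \<open>Truncated subtraction of \<open>n\<close> is injective on \<open>{n..M}\<close>,
    so no mass is counted twice.\<close>
  also have "\<dots> = (\<Sum>k\<in>(\<lambda>t. t - n) ` {n..M}. pmf (neg_binomial_pmf n p) k)"
    by (subst sum.reindex) (auto simp: inj_on_def)
  also have "\<dots> = measure (neg_binomial_pmf n p) ((\<lambda>t. t - n) ` {n..M})"
    by (simp add: measure_measure_pmf_finite)
  also have "\<dots> \<le> 1"
    by simp
  finally show ?thesis .
qed

text \<open>As \<open>\<alpha> \<le> 1\<close> gives \<open>n \<le> M\<close>, the sum contains the
  term \<open>t = n\<close>, which is \<open>p ^ n > 0\<close>; the other terms are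
  nonnegative.\<close>

lemma accept_prob_pos:
  assumes "0 < p" "p \<le> 1" "\<alpha> \<le> 1"
  shows "0 < accept_prob \<alpha> M p"
proof -
  define n where "n = nat \<lceil>\<alpha> * real M\<rceil>"
  have "\<alpha> * real M \<le> real M"
    using mult_right_mono[OF assms(3), of "real M"] by simp
  then have "n \<le> M"
    by (simp add: n_def nat_le_iff ceiling_le_iff)
  then have "real ((n - 1) choose (n - n)) * p ^ n * (1 - p) ^ (n - n)
      \<le> (\<Sum>t = n..M. real ((t - 1) choose (t - n)) * p ^ n * (1 - p) ^ (t - n))"
    using assms by (intro member_le_sum) auto
  then show ?thesis
    using assms by (auto simp: accept_prob_def n_def[symmetric] intro: less_le_trans[rotated])
qed

section \<open>Stationary distributions of finite reversible chains\<close>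

text \<open>Detailed balance turns the flow into \<open>y\<close> into the flow out of
  \<open>y\<close>, which is \<open>q y\<close> times a row sum equal to 1.\<close>

lemma reversible_stationary:
  assumes "finite S" "S \<noteq> {}" "transition_matrix S p"
    and q: "\<And>x. x \<in> S \<Longrightarrow> 0 < q x"
    and rev: "\<And>x y. x \<in> S \<Longrightarrow> y \<in> S \<Longrightarrow> q x * p x y = q y * p y x"
  shows "stationary_distribution S p (\<lambda>x. q x / sum q S)"
proof -
  have pos: "0 < sum q S"
    using assms by (intro sum_pos) auto
  have "(\<Sum>x\<in>S. q x / sum q S * p x y) = q y / sum q S" if "y \<in> S" for y
  proof -
    have "(\<Sum>x\<in>S. q x / sum q S * p x y) = (\<Sum>x\<in>S. q x * p x y) / sum q S"
      by (simp add: sum_divide_distrib)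
    also have "(\<Sum>x\<in>S. q x * p x y) = (\<Sum>x\<in>S. q y * p y x)"
      using rev that by (intro sum.cong) auto
    also have "\<dots> = q y"
      using assms(3) that by (simp add: transition_matrix_def flip: sum_distrib_left)
    finally show ?thesis .
  qed
  then show ?thesis
    using pos q by (auto simp: stationary_distribution_def less_imp_le simp flip: sum_divide_distrib)
qed

lemma harmonic_constant:
  assumes "finite S" "S \<noteq> {}" "transition_matrix S p"
    and irr: "\<And>x y. x \<in> S \<Longrightarrow> y \<in> S \<Longrightarrow> (x, y) \<in> {(u, v). u \<in> S \<and> v \<in> S \<and> 0 < p u v}\<^sup>*"
    and harm: "\<And>x. x \<in> S \<Longrightarrow> (\<Sum>y\<in>S. p x y * h y) = h x"
  obtains c :: real where "\<And>x. x \<in> S \<Longrightarrow> h x = c"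
proof -
  define c where "c = Max (h ` S)"
  have le: "h x \<le> c" if "x \<in> S" for x
    using that assms(1) by (auto simp: c_def)
  have "c \<in> h ` S"
    using assms(1,2) unfolding c_def by (intro Max_in) auto
  then obtain z where z: "z \<in> S" "h z = c"
    by auto
  have step: "h v = c" if "u \<in> S" "v \<in> S" "0 < p u v" "h u = c" for u v
  proof -
    \<comment> \<open>The gaps \<open>c - h y\<close> are nonnegative and average to 0 under
      \<open>p u\<close>, so each gap of positive weight vanishes.\<close>
    have "(\<Sum>y\<in>S. p u y * (c - h y)) = c * (\<Sum>y\<in>S. p u y) - (\<Sum>y\<in>S. p u y * h y)"
      by (simp add: algebra_simps sum_subtractf sum_distrib_left)
    also have "\<dots> = 0"
      using assms(3) harm that by (simp add: transition_matrix_def)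
    finally have "p u v * (c - h v) = 0"
      using assms(1,3) that le by (subst (asm) sum_nonneg_eq_0_iff) (auto simp: transition_matrix_def)
    then show ?thesis
      using that by simp
  qed
  \<comment> \<open>The maximal value spreads from the maximiser \<open>z\<close> along a path of
    positive transitions to \<open>x\<close>.\<close>
  have "h x = c" if "x \<in> S" for x
    using irr[OF z(1) that] by (induction rule: rtrancl_induct) (use z step in auto)
  then show ?thesis
    using that by blast
qed

text \<open>Stationarity sums over the first argument of \<open>p\<close>, harmonicity over the
  second. Passing to the density \<open>\<mu> x / q x\<close> lets reversibility exchange the two;
  total mass 1 then fixes the constant.\<close>

lemma reversible_stationary_unique:
  assumes "finite S" "S \<noteq> {}" "transition_matrix S p"
    and irr: "\<And>x y. x \<in> S \<Longrightarrow> y \<in> S \<Longrightarrow> (x, y) \<in> {(u, v). u \<in> S \<and> v \<in> S \<and> 0 < p u v}\<^sup>*"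
    and q: "\<And>x. x \<in> S \<Longrightarrow> 0 < q x"
    and rev: "\<And>x y. x \<in> S \<Longrightarrow> y \<in> S \<Longrightarrow> q x * p x y = q y * p y x"
    and \<mu>: "stationary_distribution S p \<mu>"
    and "x \<in> S"
  shows "\<mu> x = q x / sum q S"
proof -
  have harm: "(\<Sum>y\<in>S. p x y * (\<mu> y / q y)) = \<mu> x / q x" if "x \<in> S" for x
  proof -
    have "p x y * (\<mu> y / q y) = \<mu> y * p y x / q x" if "y \<in> S" for y
      using rev[OF \<open>x \<in> S\<close> that] q[OF \<open>x \<in> S\<close>] q[OF that] by (simp add: field_simps)
    then have "(\<Sum>y\<in>S. p x y * (\<mu> y / q y)) = (\<Sum>y\<in>S. \<mu> y * p y x) / q x"
      by (simp add: sum_divide_distrib)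
    then show ?thesis
      using \<mu> that by (simp add: stationary_distribution_def)
  qed
  obtain c where "\<And>x. x \<in> S \<Longrightarrow> \<mu> x / q x = c"
    using harmonic_constant[OF assms(1-3) irr harm] by blast
  then have c: "\<mu> x = c * q x" if "x \<in> S" for x
    using q[OF that] that by (metis nonzero_mult_div_cancel_right times_divide_eq_left less_irrefl)
  have "1 = (\<Sum>x\<in>S. \<mu> x)"
    using \<mu> by (simp add: stationary_distribution_def)
  also have "\<dots> = c * sum q S"
    using c by (simp add: sum_distrib_left)
  \<comment> \<open>That \<open>sum q S\<close> is nonzero follows from the equation
    \<open>1 = c * sum q S\<close> itself.\<close>
  finally have "c = 1 / sum q S"
    by (metis mult_zero_right nonzero_mult_div_cancel_right zero_neq_one)
  then show ?thesis
    using c[OF \<open>x \<in> S\<close>] by simp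
qed

section \<open>Evolution of the marginal laws\<close>

text \<open>The Markov property conditions on full histories, which are summed over here.\<close>
lemma markov_chain_step:
  assumes "finite S" "markov_chain W S p X" "y \<in> S"
  shows "\<P>(\<omega> in W. X (Suc k) \<omega> = y) = (\<Sum>x\<in>S. \<P>(\<omega> in W. X k \<omega> = x) * p x y)"
proof -
  interpret prob_space W
    using assms(2) by (simp add: markov_chain_def)
  have [measurable]: "X i \<in> measurable W (count_space S)" for i
    using assms(2) by (simp add: markov_chain_def)
  have X_in: "X i \<omega> \<in> S" if "\<omega> \<in> space W" for i \<omega>
    using measurable_space[OF _ that, of "X i" "count_space S"] by simp
  have [measurable]: "Measurable.pred W (\<lambda>\<omega>. X i \<omega> = s)" for i s
    by measurable
  \<comment> \<open>Extensional functions make the set of histories finite and give each outcome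
    exactly one history in \<open>T\<close>.\<close>
  define T where "T = PiE {..k} (\<lambda>_. S)"
  define hist where "hist s \<omega> \<longleftrightarrow> (\<forall>i\<le>k. X i \<omega> = s i)" for s \<omega>
  have [measurable]: "Measurable.pred W (hist s)" for s
    unfolding hist_def by measurable
  have "finite T"
    unfolding T_def using assms(1) by (intro finite_PiE) auto
  have hist_ex1: "\<exists>!s\<in>T. hist s \<omega>" if "\<omega> \<in> space W" for \<omega>
  proof (rule ex1I[of _ "\<lambda>i\<in>{..k}. X i \<omega>"])
    show "(\<lambda>i\<in>{..k}. X i \<omega>) \<in> T \<and> hist (\<lambda>i\<in>{..k}. X i \<omega>) \<omega>"
      using X_in[OF that] by (auto simp: T_def hist_def)
    show "s = (\<lambda>i\<in>{..k}. X i \<omega>)" if "s \<in> T \<and> hist s \<omega>" for s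
      using that by (auto simp: T_def hist_def PiE_def extensional_def restrict_def fun_eq_iff)
  qed
  have total: "\<P>(\<omega> in W. Q \<omega>) = (\<Sum>s\<in>T. \<P>(\<omega> in W. Q \<omega> \<and> hist s \<omega>))"
    if [measurable]: "Measurable.pred W Q" for Q
    by (rule prob_sum) (use \<open>finite T\<close> hist_ex1 in \<open>auto intro!: AE_I2\<close>)
  have step: "\<P>(\<omega> in W. X (Suc k) \<omega> = y \<and> hist s \<omega>) = \<P>(\<omega> in W. hist s \<omega>) * p (s k) y"
    if "s \<in> T" for s
  proof (cases "0 < \<P>(\<omega> in W. hist s \<omega>)")
    case True
    \<comment> \<open>\<open>s\<close> is unconstrained by \<open>S\<close> beyond \<open>k\<close>,
      whereas \<open>markov_chain\<close> wants values in \<open>S\<close> up to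
      \<open>Suc k\<close>; the target state \<open>y\<close> fills that place.\<close>
    define s' where "s' = s(Suc k := y)"
    have s': "\<forall>i\<le>Suc k. s' i \<in> S"
      using that \<open>y \<in> S\<close> by (auto simp: s'_def T_def PiE_def)
    have hist': "(\<lambda>\<omega>. \<forall>i\<le>k. X i \<omega> = s' i) = hist s"
      by (auto simp: hist_def s'_def fun_eq_iff)
    have "cond_prob W (\<lambda>\<omega>. X (Suc k) \<omega> = s' (Suc k)) (hist s) = p (s' k) (s' (Suc k))"
      using assms(2) s' True unfolding markov_chain_def hist'[symmetric] by blast
    then show ?thesis
      using True by (simp add: s'_def cond_prob_def field_simps)
  next
    case False
    \<comment> \<open>On a null history the Markov property is silent, but both sides are 0 by
      monotonicity.\<close>
    then have 0: "\<P>(\<omega> in W. hist s \<omega>) = 0"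
      by (simp add: not_less measure_le_0_iff)
    have "\<P>(\<omega> in W. X (Suc k) \<omega> = y \<and> hist s \<omega>) \<le> \<P>(\<omega> in W. hist s \<omega>)"
      by (rule finite_measure_mono) auto
    then show ?thesis
      using 0 by (simp add: measure_le_0_iff)
  qed
  \<comment> \<open>A history fixes the state at time \<open>k\<close>, so the joint event is the
    whole history event or empty. After the sums are swapped, only \<open>x = s k\<close>
    survives.\<close>
  have last: "\<P>(\<omega> in W. X k \<omega> = x \<and> hist s \<omega>) = (if x = s k then \<P>(\<omega> in W. hist s \<omega>) else 0)"
    for x s
  proof (cases "x = s k")
    case True
    then have "{\<omega> \<in> space W. X k \<omega> = x \<and> hist s \<omega>} = {\<omega> \<in> space W. hist s \<omega>}"
      by (auto simp: hist_def)
    then show ?thesis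
      using True by (simp only: if_True simp_thms)
  next
    case False
    then have "{\<omega> \<in> space W. X k \<omega> = x \<and> hist s \<omega>} = {}"
      by (auto simp: hist_def)
    then show ?thesis
      using False by (simp only: if_False measure_empty)
  qed
  have "(\<Sum>x\<in>S. \<P>(\<omega> in W. X k \<omega> = x) * p x y)
      = (\<Sum>x\<in>S. \<Sum>s\<in>T. (if x = s k then \<P>(\<omega> in W. hist s \<omega>) else 0) * p x y)"
    by (subst total) (simp_all add: last sum_distrib_right)
  also have "\<dots> = (\<Sum>s\<in>T. \<Sum>x\<in>S. (if x = s k then \<P>(\<omega> in W. hist s \<omega>) else 0) * p x y)"
    by (rule sum.swap)
  also have "\<dots> = (\<Sum>s\<in>T. \<P>(\<omega> in W. hist s \<omega>) * p (s k) y)"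
  proof (intro sum.cong refl)
    fix s assume "s \<in> T"
    then have "s k \<in> S"
      by (auto simp: T_def)
    then show "(\<Sum>x\<in>S. (if x = s k then \<P>(\<omega> in W. hist s \<omega>) else 0) * p x y)
        = \<P>(\<omega> in W. hist s \<omega>) * p (s k) y"
      using \<open>finite S\<close> by (simp add: if_distrib[of "\<lambda>z. z * _"] sum.delta cong: if_cong)
  qed
  also have "\<dots> = \<P>(\<omega> in W. X (Suc k) \<omega> = y)"
    by (subst total) (simp_all add: step)
  finally show ?thesis ..
qed

lemma markov_chain_stationary_marginals:
  assumes "finite S" "markov_chain W S p X" "stationary_distribution S p \<pi>"
    and "\<And>x. x \<in> S \<Longrightarrow> \<P>(\<omega> in W. X 0 \<omega> = x) = \<pi> x"
    and "x \<in> S"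
  shows "\<P>(\<omega> in W. X k \<omega> = x) = \<pi> x"
  using \<open>x \<in> S\<close>
proof (induction k arbitrary: x)
  case 0
  then show ?case
    by (rule assms(4))
next
  case (Suc k)
  then show ?case
    using assms(3) by (simp add: markov_chain_step[OF assms(1,2)] stationary_distribution_def)
qed

section \<open>The relaxed stochastic ruler chain\<close>

theorem theorem2p4:
  fixes S :: "'s set"
    and N :: "'s \<Rightarrow> 's set"
    and R :: "'s \<Rightarrow> 's \<Rightarrow> real"
    and \<Omega> :: "'w measure"
    and H :: "'s \<Rightarrow> 'w \<Rightarrow> real"
    and \<theta> :: "real \<Rightarrow> real \<Rightarrow> 'w \<Rightarrow> real"
    and f q \<pi> :: "'s \<Rightarrow> real"
    and p :: "'s \<Rightarrow> 's \<Rightarrow> real"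
    and a b \<alpha> :: real
    and M :: nat
  assumes S: "finite S" "S \<noteq> {}"
    and prob: "prob_space \<Omega>"
    and H_measurable: "\<And>x. x \<in> S \<Longrightarrow> H x \<in> borel_measurable \<Omega>"
    and H_square_integrable: "\<And>x. x \<in> S \<Longrightarrow> integrable \<Omega> (\<lambda>\<omega>. (H x \<omega>)\<^sup>2)"
    and f_def: "f = (\<lambda>x. prob_space.expectation \<Omega> (H x))"
    and \<theta>_measurable: "\<And>u v. u < v \<Longrightarrow> \<theta> u v \<in> borel_measurable \<Omega>"
    and \<theta>_uniform: "\<And>u v. u < v \<Longrightarrow> distr \<Omega> borel (\<theta> u v) = uniform_measure lborel {u..v}"
    and \<theta>_indep: "\<And>x u v. x \<in> S \<Longrightarrow> u < v \<Longrightarrow>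
          prob_space.indep_var \<Omega> borel (H x) borel (\<theta> u v)"
    and ab: "a < b"
    and P_bounds: "\<And>x. x \<in> S \<Longrightarrow> 0 < ruler_prob \<Omega> H \<theta> x a b \<and> ruler_prob \<Omega> H \<theta> x a b < 1"
    and P_order: "\<And>x x'. x \<in> S \<Longrightarrow> x' \<in> S \<Longrightarrow> f x < f x' \<Longrightarrow>
          ruler_prob \<Omega> H \<theta> x a b > ruler_prob \<Omega> H \<theta> x' a b"
    and N_subset: "\<And>x. x \<in> S \<Longrightarrow> N x \<subseteq> S - {x}"
    and R_range: "\<And>x x'. x \<in> S \<Longrightarrow> x' \<in> S \<Longrightarrow> 0 \<le> R x x' \<and> R x x' \<le> 1"
    and R_pos_iff: "\<And>x x'. x \<in> S \<Longrightarrow> x' \<in> S \<Longrightarrow> R x x' > 0 \<longleftrightarrow> x' \<in> N x"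
    and R_sum: "\<And>x. x \<in> S \<Longrightarrow> (\<Sum>x'\<in>S. R x x') = 1"
    and reachable: "\<And>x x'. x \<in> S \<Longrightarrow> x' \<in> S \<Longrightarrow> (x, x') \<in> {(u, v). u \<in> S \<and> v \<in> N u}\<^sup>*"
    and N_sym: "\<And>x x'. x \<in> S \<Longrightarrow> x' \<in> S \<Longrightarrow> x' \<in> N x \<Longrightarrow> x \<in> N x'"
    and R_sym: "\<And>x x'. x \<in> S \<Longrightarrow> x' \<in> S \<Longrightarrow> R x x' = R x' x"
    and \<alpha>: "0 < \<alpha>" "\<alpha> < 1"
    and M: "M \<ge> 1"
    and q_def: "q = (\<lambda>x. accept_prob \<alpha> M (ruler_prob \<Omega> H \<theta> x a b))"
    and p_def: "p = ruler_transition S N R q"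
    and \<pi>_def: "\<pi> = (\<lambda>x. q x / (\<Sum>x'\<in>S. q x'))"
  shows "transition_matrix S p
    \<and> stationary_distribution S p \<pi>
    \<and> (\<forall>\<mu>. stationary_distribution S p \<mu> \<longrightarrow> (\<forall>x\<in>S. \<mu> x = \<pi> x))
    \<and> (\<forall>(W :: 'v measure) X. markov_chain W S p X \<longrightarrow>
          (\<forall>x\<in>S. \<P>(\<omega> in W. X 0 \<omega> = x) = \<pi> x) \<longrightarrow>
          (\<forall>k. \<forall>x\<in>S. \<P>(\<omega> in W. X k \<omega> = x) = \<pi> x))"
proof -
  have pos: "0 < q x" and le_1: "q x \<le> 1" if "x \<in> S" for x
    using P_bounds[OF that] \<alpha> by (auto simp: q_def intro!: accept_prob_pos accept_prob_le_1)
  have R_0: "R x y = 0" if "x \<in> S" "y \<in> S" "y \<notin> N x" for x y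
    using R_range R_pos_iff that by (metis antisym_conv2)
  \<comment> \<open>Because \<open>R\<close> vanishes at non-neighbors, one formula covers every
    off-diagonal entry and no case split on \<open>N x\<close> is needed below.\<close>
  have p_off_diag: "p x y = R x y * q y" if "x \<in> S" "y \<in> S" "x \<noteq> y" for x y
    using R_0 that by (auto simp: p_def ruler_transition_def)
  have p_diag: "p x x = 1 - (\<Sum>y\<in>S. R x y * q y)" if "x \<in> S" for x
    using N_subset[OF that] by (auto simp: p_def ruler_transition_def)
  have p_sum: "(\<Sum>y\<in>S. p x y) = 1" if "x \<in> S" for x
  proof -
    \<comment> \<open>A state is not its own neighbor, so the sum in the diagonal entry is exactly
      the off-diagonal row mass.\<close>
    have "R x x = 0"
      using N_subset that by (intro R_0) auto
    then have "(\<Sum>y\<in>S. R x y * q y) = (\<Sum>y\<in>S - {x}. R x y * q y)"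
      using S that by (simp add: sum.remove)
    also have "\<dots> = (\<Sum>y\<in>S - {x}. p x y)"
      using that by (intro sum.cong) (auto simp: p_off_diag)
    finally show ?thesis
      using S that by (simp add: sum.remove[of S x "p x"] p_diag)
  qed
  have p_nonneg: "0 \<le> p x y" if "x \<in> S" "y \<in> S" for x y
  proof (cases "x = y")
    case True
    \<comment> \<open>Here \<open>q \<le> 1\<close> matters: the total probability of leaving
      \<open>x\<close> is at most the row sum of \<open>R\<close>, which is 1.\<close>
    have "(\<Sum>y\<in>S. R x y * q y) \<le> (\<Sum>y\<in>S. R x y)"
      using R_range le_1 that by (intro sum_mono) (simp add: mult_left_le)
    then show ?thesis
      using True R_sum that by (simp add: p_diag)
  next
    case False
    then show ?thesis
      using R_range pos that by (simp add: p_off_diag less_imp_le)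
  qed
  have trans: "transition_matrix S p"
    using p_sum p_nonneg by (simp add: transition_matrix_def)
  \<comment> \<open>Off the diagonal both sides are \<open>q x * q y\<close> times the symmetric
    factor \<open>R x y\<close>.\<close>
  have rev: "q x * p x y = q y * p y x" if "x \<in> S" "y \<in> S" for x y
    using R_sym that by (cases "x = y") (auto simp: p_off_diag)
  \<comment> \<open>Each neighbor step stays in \<open>S\<close> and has probability
    \<open>R u v * q v > 0\<close>, so paths of neighbors are paths of the chain.\<close>
  have irr: "(x, y) \<in> {(u, v). u \<in> S \<and> v \<in> S \<and> 0 < p u v}\<^sup>*" if "x \<in> S" "y \<in> S" for x y
  proof -
    have "{(u, v). u \<in> S \<and> v \<in> N u} \<subseteq> {(u, v). u \<in> S \<and> v \<in> S \<and> 0 < p u v}"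
      using N_subset R_pos_iff pos by (fastforce simp: p_def ruler_transition_def)
    then show ?thesis
      using reachable[OF that] rtrancl_mono by blast
  qed
  have stat: "stationary_distribution S p \<pi>"
    unfolding \<pi>_def using reversible_stationary[OF S trans pos rev] .
  moreover have "\<mu> x = \<pi> x" if "stationary_distribution S p \<mu>" "x \<in> S" for \<mu> x
    unfolding \<pi>_def using reversible_stationary_unique[OF S trans irr pos rev that] .
  ultimately show ?thesis
    using trans markov_chain_stationary_marginals[OF S(1) _ stat] by blast
qed

end
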